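(* Let $X$ be a real Banach space and let $C\subset X$ be a nonempty bounded closed convex set. Let $f_1,\dots,f_n\colon C\to\mathbb R$ be uniformly continuous dentable functions and let $\varepsilon>0$. Then there is an open half-space $H$ of $X$ such that $C\cap H\neq\emptyset$ and $$\max\{\operatorname{diam}(f_1(C\cap H)),\dots,\operatorname{diam}(f_n(C\cap H))\}<\varepsilon.$$
   Context: An open half-space of $X$ is a set $\{x\in X: x^*(x)>a\}$ with $x^*\in X^*$, $a\in\mathbb R$. A map $f\colon C\to M$ from a nonempty subset $C$ of $X$ to a metric space $M$ is called dentable if for every nonempty bounded set $A\subset C$ and every $\varepsilon>0$ there is an open half-space $H$ such that $A\cap H\neq\emptyset$ and $\operatorname{diam}(f(A\cap H))<\varepsilon$. *)

theory Defs
  imports "HOL-Analysis.Analysis"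
begin

text \<open>The zero functional is admitted, so the whole space and the empty set are half-spaces.\<close>

definition open_half_space :: "'a::real_normed_vector set \<Rightarrow> bool" where
  "open_half_space H \<longleftrightarrow> (\<exists>(\<phi> :: 'a \<Rightarrow>\<^sub>L real) a. H = {x. blinfun_apply \<phi> x > a})"

text \<open>
  The library's \<^const>\<open>diameter\<close> is real-valued, hence unspecified on unbounded sets, and
  the image of a bounded set under an arbitrary map can be unbounded. We therefore take
  diameters in the extended nonnegative reals, where an unbounded set has diameter
  \<open>\<infinity>\<close> and the empty set has diameter \<open>0\<close>.
\<close>

definition ediameter :: "'m::metric_space set \<Rightarrow> ennreal" where
  "ediameter S = (SUP (x, y) \<in> S \<times> S. ennreal (dist x y))"

text \<open>Only the values of \<open>f\<close> on \<open>C\<close> matter.\<close>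

definition dentable_on :: "'a::real_normed_vector set \<Rightarrow> ('a \<Rightarrow> 'm::metric_space) \<Rightarrow> bool" where
  "dentable_on C f \<longleftrightarrow>
     (\<forall>A \<epsilon>. A \<subseteq> C \<and> A \<noteq> {} \<and> bounded A \<and> 0 < (\<epsilon> :: real) \<longrightarrow>
        (\<exists>H. open_half_space H \<and> A \<inter> H \<noteq> {} \<and> ediameter (f ` (A \<inter> H)) < ennreal \<epsilon>))"

end

theory Submission
  imports Defs
begin

text \<open>
  The functionals defining a slice of \<open>C\<close> on which a given \<open>f\<close> oscillates little form an open
  dense subset of the dual, so finitely many functions share such a functional.
  For density near \<open>\<phi>\<close>, let \<open>A\<close> be the set of points at which some functional close to \<open>\<phi>\<close>
  attains its supremum over \<open>C\<close>; it is nonempty by the Bishop--Phelps theorem. Dentability gives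
  \<open>H = {h > b}\<close> meeting \<open>A\<close> at some \<open>x\<close>, with \<open>f\<close> oscillating little on \<open>A \<inter> H\<close>. If \<open>\<phi>'\<close> attains
  its supremum at \<open>x\<close>, then thin slices of \<open>C\<close> in direction \<open>\<phi>' + t h\<close> with small \<open>t > 0\<close> lie in \<open>H\<close>,
  and by the Brondsted--Rockafellar theorem each of their points is close to a point of \<open>A \<inter> H\<close>.
  Uniform continuity then bounds the oscillation of \<open>f\<close> on the whole slice.
\<close>

section \<open>Sublinear functionals and their linear minorants (Hahn--Banach)\<close>

text \<open>Asking only for an inequality and only for \<open>c > 0\<close> shortens later
  verifications. Equality follows by scaling back with \<open>inverse c\<close>, and
  \<open>p 0 = 0\<close> by comparing with \<open>c = 1/2\<close>.\<close>

definition sublinear :: "('a::real_vector \<Rightarrow> real) \<Rightarrow> bool" where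
  "sublinear p \<longleftrightarrow> (\<forall>u v. p (u + v) \<le> p u + p v) \<and> (\<forall>c>0. \<forall>v. p (c *\<^sub>R v) \<le> c * p v)"

lemma sublinear_zero:
  assumes "sublinear p"
  shows "p 0 = 0"
proof -
  have "p (0 + 0) \<le> p 0 + p 0"
    using assms unfolding sublinear_def by blast
  moreover have "p ((1/2) *\<^sub>R 0) \<le> 1/2 * p 0"
    using assms unfolding sublinear_def by (meson half_gt_zero zero_less_one)
  ultimately show ?thesis by simp
qed

lemma sublinear_scaleR:
  assumes "sublinear p" "c \<ge> 0"
  shows "p (c *\<^sub>R v) = c * p v"
proof (cases "c = 0")
  case True
  then show ?thesis using sublinear_zero[OF assms(1)] by simp
next
  case False
  with assms have c: "c > 0" by simp
  have "p (inverse c *\<^sub>R (c *\<^sub>R v)) \<le> inverse c * p (c *\<^sub>R v)"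
    using assms(1) c unfolding sublinear_def by (meson positive_imp_inverse_positive)
  then have "c * p v \<le> p (c *\<^sub>R v)"
    using c by (simp add: field_simps)
  moreover have "p (c *\<^sub>R v) \<le> c * p v"
    using assms(1) c unfolding sublinear_def by blast
  ultimately show ?thesis by simp
qed

text \<open>Every sublinear functional constructed below is a pointwise infimum. The conditions
  concern single elements of the sets, so each use reduces to exhibiting one competitor
  \<open>d\<close>.\<close>

lemma sublinear_Inf:
  fixes S :: "'a::real_vector \<Rightarrow> real set"
  assumes ne: "\<And>v. S v \<noteq> {}" and bdd: "\<And>v. bdd_below (S v)"
    and add: "\<And>u v a b. a \<in> S u \<Longrightarrow> b \<in> S v \<Longrightarrow> \<exists>d\<in>S (u + v). d \<le> a + b"
    and scale: "\<And>c v a. c > 0 \<Longrightarrow> a \<in> S v \<Longrightarrow> \<exists>d\<in>S (c *\<^sub>R v). d \<le> c * a"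
  shows "sublinear (\<lambda>v. Inf (S v))"
  unfolding sublinear_def
proof (intro conjI allI impI)
  fix u v
  have *: "Inf (S (u + v)) \<le> a + b" if "a \<in> S u" "b \<in> S v" for a b
    using add[OF that] cInf_lower[OF _ bdd] by (meson order_trans)
  have "Inf (S (u + v)) - b \<le> Inf (S u)" if "b \<in> S v" for b
    by (rule cInf_greatest[OF ne]) (use *[OF _ that] in \<open>simp add: algebra_simps\<close>)
  then have "Inf (S (u + v)) - Inf (S u) \<le> Inf (S v)"
    by (intro cInf_greatest[OF ne]) (simp add: algebra_simps)
  then show "Inf (S (u + v)) \<le> Inf (S u) + Inf (S v)" by simp
next
  fix c :: real and v assume c: "c > 0"
  have "Inf (S (c *\<^sub>R v)) \<le> c * a" if "a \<in> S v" for a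
    using scale[OF c that] cInf_lower[OF _ bdd] by (meson order_trans)
  then have "Inf (S (c *\<^sub>R v)) / c \<le> Inf (S v)"
    using c by (intro cInf_greatest[OF ne]) (simp add: field_simps)
  then show "Inf (S (c *\<^sub>R v)) \<le> c * Inf (S v)"
    using c by (simp add: field_simps)
qed

text \<open>Minimality forces \<open>q\<close> to coincide with any sublinear minorant, so it
  inherits \<open>q (- u) \<le> - q u\<close> from a suitable one; subadditivity at \<open>u\<close>
  and \<open>- u\<close> gives the converse.\<close>

lemma minimal_sublinear_odd:
  assumes q: "sublinear q" and min: "\<And>r. sublinear r \<Longrightarrow> r \<le> q \<Longrightarrow> r = q"
  shows "q (- u) = - q u"
proof -
  \<comment> \<open>the largest sublinear minorant \<open>r\<close> of \<open>q\<close> with \<open>r (- u) \<le> - q u\<close>\<close>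
  define S where "S v = (\<lambda>t. q (v + t *\<^sub>R u) - t * q u) ` {0..}" for v
  have sub: "q (x + y) \<le> q x + q y" for x y
    using q unfolding sublinear_def by blast
  have bdd: "bdd_below (S v)" for v
  proof (rule bdd_belowI)
    fix a assume "a \<in> S v"
    then obtain t where t: "t \<ge> 0" "a = q (v + t *\<^sub>R u) - t * q u"
      unfolding S_def by auto
    have "q (t *\<^sub>R u) \<le> q (v + t *\<^sub>R u) + q (- v)"
      using sub[of "v + t *\<^sub>R u" "- v"] by simp
    then show "- q (- v) \<le> a"
      using t sublinear_scaleR[OF q] by simp
  qed
  have "sublinear (\<lambda>v. Inf (S v))"
  proof (rule sublinear_Inf[OF _ bdd])
    show "S v \<noteq> {}" for v unfolding S_def by auto
  next
    fix v w a b assume "a \<in> S v" "b \<in> S w"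
    then obtain s t where st: "s \<ge> 0" "t \<ge> 0" and ab: "a = q (v + s *\<^sub>R u) - s * q u"
        "b = q (w + t *\<^sub>R u) - t * q u"
      unfolding S_def by auto
    have "q (v + w + (s + t) *\<^sub>R u) - (s + t) * q u \<in> S (v + w)"
      using st unfolding S_def by auto
    moreover have "q (v + w + (s + t) *\<^sub>R u) \<le> q (v + s *\<^sub>R u) + q (w + t *\<^sub>R u)"
      using sub[of "v + s *\<^sub>R u" "w + t *\<^sub>R u"] by (simp add: algebra_simps)
    ultimately show "\<exists>d\<in>S (v + w). d \<le> a + b"
      using ab by (intro bexI) (auto simp: algebra_simps)
  next
    fix c :: real and v a assume c: "c > 0" and "a \<in> S v"
    then obtain t where t: "t \<ge> 0" "a = q (v + t *\<^sub>R u) - t * q u"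
      unfolding S_def by auto
    have "q (c *\<^sub>R v + (c * t) *\<^sub>R u) - (c * t) * q u \<in> S (c *\<^sub>R v)"
      using t c unfolding S_def by auto
    moreover have "q (c *\<^sub>R v + (c * t) *\<^sub>R u) = c * q (v + t *\<^sub>R u)"
      using sublinear_scaleR[OF q, of c "v + t *\<^sub>R u"] c by (simp add: algebra_simps)
    ultimately show "\<exists>d\<in>S (c *\<^sub>R v). d \<le> c * a"
      unfolding t(2) by (intro bexI) (auto simp: algebra_simps)
  qed
  moreover have "(\<lambda>v. Inf (S v)) \<le> q"
  proof (rule le_funI, rule cInf_lower[OF _ bdd])
    show "q v \<in> S v" for v unfolding S_def by (rule image_eqI[of _ _ 0]) auto
  qed
  ultimately have "q (- u) = Inf (S (- u))"
    using min by (metis (no_types, lifting))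
  also have "\<dots> \<le> - q u"
  proof (rule cInf_lower[OF _ bdd])
    show "- q u \<in> S (- u)"
      unfolding S_def by (rule image_eqI[of _ _ 1]) (auto simp: sublinear_zero[OF q])
  qed
  finally have "q (- u) \<le> - q u" .
  moreover have "0 \<le> q u + q (- u)"
    using sub[of u "- u"] sublinear_zero[OF q] by simp
  ultimately show ?thesis by simp
qed

text \<open>Zorn's lemma yields a minimal sublinear minorant of \<open>p\<close>. It is odd, and for
  odd functions subadditivity reverses to additivity. The pointwise infimum of a chain is finite
  because every minorant of \<open>p\<close> is at least \<open>- p (- v)\<close> at
  \<open>v\<close>.\<close>

lemma sublinear_dominates_linear:
  assumes p: "sublinear p"
  obtains g where "linear g" "\<And>v. g v \<le> p v"
proof -
  define A where "A = {q. sublinear q \<and> q \<le> p}"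
  \<comment> \<open>The order is reversed, so that the maximal element supplied by Zorn's lemma is a
    minimal function.\<close>
  have po: "partial_order_on A (relation_of (\<ge>) A)"
    by (rule partial_order_on_relation_ofI) auto
  have "\<exists>l\<in>A. \<forall>q\<in>Ch. q \<ge> l" if Ch: "Ch \<in> Chains (relation_of (\<ge>) A)" for Ch
  proof (cases "Ch = {}")
    case True
    then show ?thesis using p unfolding A_def by auto
  next
    case False
    have ChA: "q \<in> A" if "q \<in> Ch" for q
      using Ch that unfolding Chains_def relation_of_def by auto
    have total: "q \<le> r \<or> r \<le> q" if "q \<in> Ch" "r \<in> Ch" for q r
      using Ch that unfolding Chains_def relation_of_def by auto
    define S where "S v = (\<lambda>q. q v) ` Ch" for v
    have bdd: "bdd_below (S v)" for v
    proof (rule bdd_belowI)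
      fix a assume "a \<in> S v"
      then obtain q where q: "q \<in> Ch" "a = q v" unfolding S_def by auto
      then have sq: "sublinear q" and "q (- v) \<le> p (- v)"
        using ChA unfolding A_def by (auto simp: le_fun_def)
      moreover have "0 \<le> q v + q (- v)"
        using sq sublinear_zero[OF sq] unfolding sublinear_def by (metis add.right_inverse)
      ultimately show "- p (- v) \<le> a" using q by simp
    qed
    have "sublinear (\<lambda>v. Inf (S v))"
    proof (rule sublinear_Inf[OF _ bdd])
      show "S v \<noteq> {}" for v using False unfolding S_def by auto
    next
      fix v w a b assume "a \<in> S v" "b \<in> S w"
      then obtain q r where qr: "q \<in> Ch" "r \<in> Ch" "a = q v" "b = r w"
        unfolding S_def by auto
      then obtain k where k: "k \<in> Ch" "k \<le> q" "k \<le> r"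
        using total by blast
      then have "k (v + w) \<le> k v + k w"
        using ChA unfolding A_def sublinear_def by blast
      also have "\<dots> \<le> a + b"
        using k qr by (simp add: le_fun_def add_mono)
      finally show "\<exists>d\<in>S (v + w). d \<le> a + b"
        using k unfolding S_def by auto
    next
      fix c :: real and v a assume "c > 0" "a \<in> S v"
      then show "\<exists>d\<in>S (c *\<^sub>R v). d \<le> c * a"
        using ChA unfolding S_def A_def sublinear_def by auto
    qed
    moreover have lower: "(\<lambda>v. Inf (S v)) \<le> q" if "q \<in> Ch" for q
      by (rule le_funI, rule cInf_lower[OF _ bdd]) (use that in \<open>auto simp: S_def\<close>)
    moreover have "(\<lambda>v. Inf (S v)) \<le> p"
    proof -
      obtain q where "q \<in> Ch" using False by auto
      then show ?thesis using lower ChA unfolding A_def by (blast intro: order_trans)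
    qed
    ultimately show ?thesis unfolding A_def by (intro bexI[of _ "\<lambda>v. Inf (S v)"]) auto
  qed
  from predicate_Zorn[OF po this] obtain g
    where g: "g \<in> A" and min: "\<And>r. r \<in> A \<Longrightarrow> r \<le> g \<Longrightarrow> r = g"
    by blast
  have sg: "sublinear g" and gp: "g \<le> p" using g unfolding A_def by auto
  have odd: "g (- u) = - g u" for u
    by (rule minimal_sublinear_odd[OF sg]) (use min gp in \<open>auto simp: A_def\<close>)
  have sub: "g (u + v) \<le> g u + g v" for u v
    using sg unfolding sublinear_def by blast
  have "linear g"
  proof (rule linearI)
    fix u v
    show "g (u + v) = g u + g v"
      using sub[of u v] sub[of "u + v" "- v"] odd[of v] by simp
  next
    fix c u
    show "g (c *\<^sub>R u) = c *\<^sub>R g u"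
      using sublinear_scaleR[OF sg, of c u] sublinear_scaleR[OF sg, of "- c" u] odd[of "c *\<^sub>R u"]
      by (cases "c \<ge> 0") auto
  qed
  with gp that show thesis by (auto simp: le_fun_def)
qed

section \<open>Variational principles of Ekeland and Brondsted--Rockafellar\<close>

text \<open>\<open>F w\<close> collects the points that improve on \<open>w\<close> by at least
  \<open>s\<close> times their distance from it. By the triangle inequality this is a preorder; a
  nearly greedy ascent from \<open>y\<close> has nested sets \<open>F\<close> shrinking to a point
  \<open>w\<close>, and nothing but \<open>w\<close> lies in \<open>F w\<close>.\<close>

lemma ekeland_variational_principle:
  fixes S :: "'a::complete_space set" and g :: "'a \<Rightarrow> real"
  assumes S: "closed S" and cont: "continuous_on S g" and bdd: "bdd_above (g ` S)"
    and s: "s > 0" and y: "y \<in> S"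
  obtains w where "w \<in> S" "g w \<ge> g y + s * dist w y" "\<And>z. z \<in> S \<Longrightarrow> g z \<le> g w + s * dist z w"
proof -
  define F where "F w = {z \<in> S. g z \<ge> g w + s * dist z w}" for w
  have FS: "F w \<subseteq> S" for w unfolding F_def by auto
  have self: "w \<in> F w" if "w \<in> S" for w using that unfolding F_def by auto
  have bddF: "bdd_above (g ` F w)" for w
    by (rule bdd_above_mono[OF bdd]) (use FS in auto)
  have trans: "F z \<subseteq> F w" if "z \<in> F w" for z w
  proof
    fix t assume "t \<in> F z"
    then show "t \<in> F w"
      using that s mult_left_mono[OF dist_triangle[of t w z], of s]
      unfolding F_def by (auto simp: algebra_simps)
  qed
  have clF: "closed (F w)" for w
  proof -
    have "closed {z \<in> S. g w + s * dist z w \<le> g z}"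
      by (rule continuous_on_closed_Collect_le) (auto intro!: continuous_intros cont S)
    then show ?thesis unfolding F_def by simp
  qed
  \<comment> \<open>Each \<open>u (Suc n)\<close> comes within \<open>(1/2)^n\<close> of the
    supremum of \<open>g\<close> over \<open>F (u n)\<close>. A point of the smaller set
    \<open>F (u (Suc n))\<close> can therefore gain at most \<open>(1/2)^n\<close> more, which
    bounds its distance from \<open>u (Suc n)\<close>.\<close>
  have "\<exists>u. \<forall>n::nat. u n \<in> F y \<and>
      (u (Suc n) \<in> F (u n) \<and> (\<forall>z\<in>F (u n). g z \<le> g (u (Suc n)) + (1/2)^n))"
  proof (rule dependent_nat_choice)
    show "\<exists>u. u \<in> F y" using self[OF y] by blast
  next
    fix w and n :: nat assume w: "w \<in> F y"
    have "\<exists>z\<in>F w. Sup (g ` F w) - (1/2)^n < g z"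
      using less_cSup_iff[OF _ bddF, of w "Sup (g ` F w) - (1/2)^n"] self[of w] w FS by auto
    then obtain z where z: "z \<in> F w" "Sup (g ` F w) - (1/2)^n < g z" by blast
    moreover have "g x \<le> Sup (g ` F w)" if "x \<in> F w" for x
      using that by (intro cSup_upper bddF) auto
    ultimately show "\<exists>z. z \<in> F y \<and> (z \<in> F w \<and> (\<forall>x\<in>F w. g x \<le> g z + (1/2)^n))"
      using trans[OF w] by (intro exI[of _ z]) force
  qed
  then obtain u where u: "\<And>n. u n \<in> F y" "\<And>n. u (Suc n) \<in> F (u n)"
      "\<And>n z. z \<in> F (u n) \<Longrightarrow> g z \<le> g (u (Suc n)) + (1/2)^n" by blast
  have small: "s * dist z (u (Suc n)) \<le> (1/2)^n" if "z \<in> F (u (Suc n))" for z n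
    using that u(3)[of z n] trans[OF u(2)[of n]] unfolding F_def by auto
  obtain w where w: "\<And>n. w \<in> F (u n)"
  proof (rule decreasing_closed_nest[of "\<lambda>n. F (u n)"])
    show "closed (F (u n))" for n by (rule clF)
    show "F (u n) \<noteq> {}" for n using u(2) by auto
    show "F (u n) \<subseteq> F (u m)" if "m \<le> n" for m n
      using that by (rule lift_Suc_antimono_le[rotated]) (rule trans[OF u(2)])
    fix e :: real assume "e > 0"
    then obtain n :: nat where n: "(1/2)^n < s * e / 2"
      using s real_arch_pow_inv[of "s * e / 2" "1/2"] by auto
    have "dist x z < e" if "x \<in> F (u (Suc n))" "z \<in> F (u (Suc n))" for x z
    proof -
      have "s * dist x z \<le> s * dist x (u (Suc n)) + s * dist z (u (Suc n))"
        using mult_left_mono[OF dist_triangle2[of x z "u (Suc n)"], of s] s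
        by (simp add: algebra_simps)
      also have "\<dots> < s * e" using small[OF that(1)] small[OF that(2)] n by simp
      finally show ?thesis using s by simp
    qed
    then show "\<exists>n. \<forall>x\<in>F (u n). \<forall>z\<in>F (u n). dist x z < e" by blast
  qed blast
  have wS: "w \<in> S" using w FS by blast
  \<comment> \<open>\<open>F w\<close> lies in every \<open>F (u n)\<close>, and these have
    arbitrarily small diameter.\<close>
  have max: "z = w" if "z \<in> F w" for z
  proof (rule ccontr)
    assume "z \<noteq> w"
    then have d: "s * dist z w > 0" using s by simp
    obtain n :: nat where n: "(1/2)^n < s * dist z w / 2"
      using d real_arch_pow_inv[of "s * dist z w / 2" "1/2"] by auto
    have "z \<in> F (u (Suc n))" using trans[OF w] that by blast
    then have "s * dist z w \<le> (1/2)^n + (1/2)^n"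
      using small[of z n] small[OF w] mult_left_mono[OF dist_triangle2[of z w "u (Suc n)"], of s] s
      by (simp add: distrib_left) (use small[OF w, of n] in linarith)
    then show False using n by simp
  qed
  show thesis
  proof (rule that[OF wS])
    show "g w \<ge> g y + s * dist w y" using w[of 0] trans[OF u(1)] unfolding F_def by blast
    show "g z \<le> g w + s * dist z w" if "z \<in> S" for z
      using max[of z] that unfolding F_def by force
  qed
qed

text \<open>Ekeland's principle with slope \<open>s\<close> spends the allowed gain
  \<open>s * s\<close> on a distance of at most \<open>s\<close>. Then
  \<open>\<phi> z - s * dist z w\<close> is maximal over \<open>C\<close> at \<open>w\<close>, and
  Hahn--Banach replaces the distance by a linear functional \<open>g\<close> of norm at most
  \<open>s\<close>; the result is \<open>\<psi> = \<phi> - g\<close>.\<close>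

lemma bronsted_rockafellar:
  fixes C :: "'a::banach set" and \<phi> :: "'a \<Rightarrow>\<^sub>L real"
  assumes C: "convex C" "closed C" and y: "y \<in> C" and s: "s > 0"
    and near: "\<And>z. z \<in> C \<Longrightarrow> \<phi> z \<le> \<phi> y + s\<^sup>2"
  obtains w \<psi> where "w \<in> C" "dist w y \<le> s" "dist \<psi> \<phi> \<le> s" "\<And>z. z \<in> C \<Longrightarrow> blinfun_apply \<psi> z \<le> \<psi> w"
proof -
  have "bdd_above (blinfun_apply \<phi> ` C)"
    using near by (intro bdd_aboveI[of _ "\<phi> y + s\<^sup>2"]) auto
  moreover have "continuous_on C (blinfun_apply \<phi>)"
    by (intro continuous_intros)
  ultimately obtain w where w: "w \<in> C" and up: "\<phi> w \<ge> \<phi> y + s * dist w y"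
      and wmax: "\<And>z. z \<in> C \<Longrightarrow> \<phi> z \<le> \<phi> w + s * dist z w"
    using ekeland_variational_principle[OF C(2) _ _ s y] by blast
  have wy: "dist w y \<le> s"
  proof -
    have "s * dist w y \<le> s * s"
      using up near[OF w] by (simp add: power2_eq_square)
    then show ?thesis using s by simp
  qed
  \<comment> \<open>A linear \<open>g\<close> below \<open>Inf (S v)\<close> satisfies \<open>g v \<le> s * norm v\<close> (take \<open>t = 0\<close>) and
    \<open>g (w - z) \<le> \<phi> w - \<phi> z\<close> (take \<open>t = 1\<close>), so \<open>\<phi> - g\<close> is maximal at \<open>w\<close>.\<close>
  define S where "S v = {s * norm (v - t *\<^sub>R (w - z)) + t * (\<phi> w - \<phi> z) | t z. t \<ge> 0 \<and> z \<in> C}" for v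
  \<comment> \<open>The maximality of \<open>w\<close> enters here: a possibly negative
    \<open>t * (\<phi> w - \<phi> z)\<close> is compensated by the norm term up to
    \<open>s * norm v\<close>.\<close>
  have lower: "- s * norm v \<le> a" if "a \<in> S v" for a v
  proof -
    obtain t z where t: "t \<ge> 0" "z \<in> C" "a = s * norm (v - t *\<^sub>R (w - z)) + t * (\<phi> w - \<phi> z)"
      using \<open>a \<in> S v\<close> unfolding S_def by (elim CollectE exE conjE) (rule that)
    have "norm (t *\<^sub>R (w - z)) - norm v \<le> norm (v - t *\<^sub>R (w - z))"
      by (metis norm_minus_commute norm_triangle_ineq2)
    then have "s * (norm (t *\<^sub>R (w - z)) - norm v) \<le> s * norm (v - t *\<^sub>R (w - z))"
      using s by (intro mult_left_mono) auto
    then have "s * (t * norm (w - z)) - s * norm v \<le> s * norm (v - t *\<^sub>R (w - z))"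
      using t(1) by (simp add: right_diff_distrib)
    moreover have "t * (\<phi> z - \<phi> w) \<le> t * (s * norm (w - z))"
      using wmax[OF t(2)] t(1) by (intro mult_left_mono) (auto simp: dist_norm norm_minus_commute)
    ultimately show ?thesis using t by (simp add: algebra_simps)
  qed
  have bdd: "bdd_below (S v)" for v
    using lower by (rule bdd_belowI)
  have mem: "s * norm (v - t *\<^sub>R (w - z)) + t * (\<phi> w - \<phi> z) \<in> S v" if "t \<ge> 0" "z \<in> C" for v t z
    using that unfolding S_def by auto
  have "sublinear (\<lambda>v. Inf (S v))"
  proof (rule sublinear_Inf[OF _ bdd])
    show "S v \<noteq> {}" for v using mem[of 0, OF _ w] by auto
  next
    fix u v a b assume "a \<in> S u" "b \<in> S v"
    then obtain t x t' z where tx: "t \<ge> 0" "x \<in> C" "a = s * norm (u - t *\<^sub>R (w - x)) + t * (\<phi> w - \<phi> x)"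
      and tz: "t' \<ge> 0" "z \<in> C" "b = s * norm (v - t' *\<^sub>R (w - z)) + t' * (\<phi> w - \<phi> z)"
      unfolding S_def by (elim CollectE exE conjE) (rule that)
    \<comment> \<open>Convexity merges the two rays: \<open>k\<close> is the weighted mean of
      \<open>x\<close> and \<open>z\<close>. If both weights vanish, any point of \<open>C\<close>
      serves.\<close>
    obtain k where k: "k \<in> C" "(t + t') *\<^sub>R k = t *\<^sub>R x + t' *\<^sub>R z"
    proof (cases "t + t' = 0")
      case True
      then show thesis using that[OF w] tx tz by (auto simp: add_nonneg_eq_0_iff)
    next
      case False
      show thesis
      proof (rule that)
        show "(t / (t + t')) *\<^sub>R x + (t' / (t + t')) *\<^sub>R z \<in> C"
          using tx tz False by (intro convexD[OF C(1)]) (auto simp: add_divide_distrib[symmetric])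
        show "(t + t') *\<^sub>R ((t / (t + t')) *\<^sub>R x + (t' / (t + t')) *\<^sub>R z) = t *\<^sub>R x + t' *\<^sub>R z"
          using False by (simp add: scaleR_right_distrib)
      qed
    qed
    have "(t + t') * \<phi> k = t * \<phi> x + t' * \<phi> z"
      using arg_cong[OF k(2), of "blinfun_apply \<phi>"] by (simp add: blinfun.bilinear_simps)
    moreover have "norm (u + v - (t + t') *\<^sub>R (w - k)) \<le> norm (u - t *\<^sub>R (w - x)) + norm (v - t' *\<^sub>R (w - z))"
    proof -
      have "u + v - (t + t') *\<^sub>R (w - k) = (u - t *\<^sub>R (w - x)) + (v - t' *\<^sub>R (w - z))"
        using k(2) by (simp add: algebra_simps)
      then show ?thesis by (metis norm_triangle_ineq)
    qed
    then have "s * norm (u + v - (t + t') *\<^sub>R (w - k))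
        \<le> s * norm (u - t *\<^sub>R (w - x)) + s * norm (v - t' *\<^sub>R (w - z))"
      using s by (simp flip: distrib_left)
    ultimately have "s * norm (u + v - (t + t') *\<^sub>R (w - k)) + (t + t') * (\<phi> w - \<phi> k) \<le> a + b"
      unfolding tx(3) tz(3) by (simp add: right_diff_distrib distrib_right)
    then show "\<exists>d\<in>S (u + v). d \<le> a + b"
      using mem[of "t + t'" k "u + v"] tx tz k by auto
  next
    fix c :: real and v a assume c: "c > 0" and "a \<in> S v"
    then obtain t z where t: "t \<ge> 0" "z \<in> C" "a = s * norm (v - t *\<^sub>R (w - z)) + t * (\<phi> w - \<phi> z)"
      unfolding S_def by (elim CollectE exE conjE) (rule that)
    have "norm (c *\<^sub>R v - (c * t) *\<^sub>R (w - z)) = c * norm (v - t *\<^sub>R (w - z))"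
    proof -
      have "c *\<^sub>R v - (c * t) *\<^sub>R (w - z) = c *\<^sub>R (v - t *\<^sub>R (w - z))"
        by (simp add: scaleR_right_diff_distrib)
      then show ?thesis using c by simp
    qed
    then have "s * norm (c *\<^sub>R v - (c * t) *\<^sub>R (w - z)) + (c * t) * (\<phi> w - \<phi> z) = c * a"
      unfolding t(3) by (simp add: distrib_left)
    then show "\<exists>d\<in>S (c *\<^sub>R v). d \<le> c * a"
      using mem[of "c * t" z "c *\<^sub>R v"] c t by auto
  qed
  then obtain g where g: "linear g" "\<And>v. g v \<le> Inf (S v)"
    using sublinear_dominates_linear by blast
  have gS: "g v \<le> a" if "a \<in> S v" for a v
    using g(2) cInf_lower[OF that bdd] by (rule order_trans)
  have "g v \<le> s * norm v" for v
    using gS[OF mem[of 0, OF _ w]] by simp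
  from this this[of "- v" for v] have gn: "norm (g v) \<le> norm v * s" for v
    using linear_neg[OF g(1)] by (auto simp: abs_le_iff mult.commute)
  then have "bounded_linear g"
    using g(1) by (intro bounded_linear_intro[of g s]) (auto simp: linear_add linear_cmul)
  then have app: "blinfun_apply (Blinfun g) = g"
    by (rule bounded_linear_Blinfun_apply)
  show thesis
  proof (rule that[OF w wy])
    show "dist (\<phi> - Blinfun g) \<phi> \<le> s"
      using norm_blinfun_bound[of s "Blinfun g"] gn s by (simp add: dist_norm app mult.commute)
    show "blinfun_apply (\<phi> - Blinfun g) z \<le> blinfun_apply (\<phi> - Blinfun g) w" if "z \<in> C" for z
      using gS[OF mem[of 1 z "w - z"]] that linear_diff[OF g(1), of w z]
      by (simp add: blinfun.diff_left app)
  qed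
qed

section \<open>Density of the functionals with a slice of small oscillation\<close>

lemma dist_le_ediameter:
  assumes "x \<in> S" "y \<in> S"
  shows "ennreal (dist x y) \<le> ediameter S"
  unfolding ediameter_def using assms by (intro SUP_upper2[of "(x, y)"]) auto

text \<open>Dentability of \<open>C\<close> alone would give a functional unrelated to
  \<open>\<phi>\<close>. Applied to \<open>A\<close>, it gives an \<open>h\<close> that enters with
  a small weight \<open>t\<close> only. The bound \<open>e\<close> splits into thirds: from
  \<open>y\<close> to a point of \<open>A\<close>, within \<open>A \<inter> H\<close>, and back to
  \<open>z\<close>.\<close>

lemma dense_slicing_functionals:
  fixes C :: "'a::banach set" and f :: "'a \<Rightarrow> 'm::metric_space" and \<phi> :: "'a \<Rightarrow>\<^sub>L real"
  assumes C: "C \<noteq> {}" "bounded C" "closed C" "convex C"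
    and uc: "uniformly_continuous_on C f" and dent: "dentable_on C f"
    and r: "r > 0" and e: "e > 0"
  obtains \<psi> :: "'a \<Rightarrow>\<^sub>L real" and a x where "dist \<psi> \<phi> < r" "x \<in> C" "blinfun_apply \<psi> x > a"
    "\<And>y z. \<lbrakk>y \<in> C; z \<in> C; blinfun_apply \<psi> y > a; blinfun_apply \<psi> z > a\<rbrakk> \<Longrightarrow> dist (f y) (f z) \<le> e"
proof -
  have bdd: "bdd_above (blinfun_apply \<psi> ` C)" for \<psi> :: "'a \<Rightarrow>\<^sub>L real"
    using bounded_linear_image[OF C(2) blinfun.bounded_linear_right, of \<psi>]
    by (rule bounded_imp_bdd_above)
  have near: "\<exists>y\<in>C. Sup (blinfun_apply \<psi> ` C) - d < blinfun_apply \<psi> y" if "d > 0" for \<psi> :: "'a \<Rightarrow>\<^sub>L real" and d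
    using that C(1) less_cSup_iff[OF _ bdd, of \<psi> "Sup (blinfun_apply \<psi> ` C) - d"] by auto
  have le_Sup: "blinfun_apply \<psi> z \<le> Sup (blinfun_apply \<psi> ` C)" if "z \<in> C" for \<psi> :: "'a \<Rightarrow>\<^sub>L real" and z
    using that by (intro cSup_upper bdd) auto
  define A where "A = {x \<in> C. \<exists>\<psi>. dist \<psi> \<phi> < r \<and> (\<forall>z\<in>C. blinfun_apply \<psi> z \<le> blinfun_apply \<psi> x)}"
  \<comment> \<open>The margin \<open>s\<close> absorbs the change of functional in
    Brondsted--Rockafellar, so the supporting functional stays within \<open>r\<close> of
    \<open>\<phi>\<close>.\<close>
  have attain: "\<exists>w\<in>A. dist w y \<le> s"
    if y: "y \<in> C" and s: "s > 0" and big: "blinfun_apply \<psi> y > Sup (blinfun_apply \<psi> ` C) - s\<^sup>2"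
      and \<psi>: "dist \<psi> \<phi> + s < r" for \<psi> y s
  proof -
    have le: "blinfun_apply \<psi> z \<le> blinfun_apply \<psi> y + s\<^sup>2" if "z \<in> C" for z
      using le_Sup[OF that, of \<psi>] big by simp
    obtain w \<psi>' where w: "w \<in> C" "dist w y \<le> s" "dist \<psi>' \<psi> \<le> s"
        "\<And>z. z \<in> C \<Longrightarrow> blinfun_apply \<psi>' z \<le> \<psi>' w"
      using bronsted_rockafellar[OF C(4,3) y s le] by blast
    moreover have "dist \<psi>' \<phi> < r"
      using dist_triangle[of \<psi>' \<phi> \<psi>] w(3) \<psi> by simp
    ultimately show ?thesis unfolding A_def by auto
  qed
  have "A \<noteq> {}"
    using near[of "(r/2)\<^sup>2" \<phi>] attain[of _ "r/2" \<phi>] r by fastforce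
  moreover have "A \<subseteq> C" "bounded A"
    using C(2) unfolding A_def by (auto intro: bounded_subset)
  ultimately obtain H where H: "open_half_space H" "A \<inter> H \<noteq> {}" "ediameter (f ` (A \<inter> H)) < ennreal (e/3)"
    using dent e unfolding dentable_on_def by (meson divide_pos_pos zero_less_numeral)
  then obtain h :: "'a \<Rightarrow>\<^sub>L real" and b where hb: "H = {x. h x > b}"
    unfolding open_half_space_def by auto
  have osc: "dist (f y) (f z) < e/3" if "y \<in> A" "z \<in> A" "h y > b" "h z > b" for y z
    using order_le_less_trans[OF dist_le_ediameter H(3)] that hb
    by (auto simp: ennreal_less_iff)
  obtain x \<phi>' where x: "x \<in> C" "h x > b" "dist \<phi>' \<phi> < r" "\<And>z. z \<in> C \<Longrightarrow> blinfun_apply \<phi>' z \<le> \<phi>' x"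
    using H(2) hb unfolding A_def by auto
  \<comment> \<open>The weight leaves \<open>\<phi>' + t *\<^sub>R h\<close> within \<open>r\<close>
    of \<open>\<phi>\<close>; the \<open>+ 1\<close> covers \<open>h = 0\<close>.\<close>
  define t where "t = (r - dist \<phi>' \<phi>) / (2 * (norm h + 1))"
  have t: "t > 0" "t * norm h < r - dist \<phi>' \<phi>"
  proof -
    have n: "norm h + 1 > 0" by (simp add: add_nonneg_pos)
    then show "t > 0" using x(3) unfolding t_def by simp
    then have "t * norm h < t * (2 * (norm h + 1))" by (simp add: add_nonneg_pos)
    also have "\<dots> = r - dist \<phi>' \<phi>" using n unfolding t_def by simp
    finally show "t * norm h < r - dist \<phi>' \<phi>" .
  qed
  define \<psi> where "\<psi> = \<phi>' + t *\<^sub>R h"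
  have \<psi>: "dist \<psi> \<phi> < r"
    using dist_triangle[of \<psi> \<phi> \<phi>'] t by (simp add: \<psi>_def dist_norm[of "\<phi>' + _" \<phi>'])
  obtain d where d: "d > 0" "\<And>y z. y \<in> C \<Longrightarrow> z \<in> C \<Longrightarrow> dist z y < d \<Longrightarrow> dist (f z) (f y) < e/3"
    using uc e unfolding uniformly_continuous_on_def by (metis divide_pos_pos zero_less_numeral)
  \<comment> \<open>A slice of depth \<open>s\<^sup>2\<close> costs at most
    \<open>s\<^sup>2 / t\<close> in the value of \<open>h\<close>, and moving by \<open>s\<close> to
    a point of \<open>A\<close> costs \<open>s * norm h\<close>. Together they must stay below the
    reserve \<open>h x - b\<close>.\<close>
  have "((\<lambda>s. s * norm h + s\<^sup>2 / t) \<longlongrightarrow> 0 * norm h + 0\<^sup>2 / t) (at_right 0)"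
    using t by (intro tendsto_intros) auto
  then have "\<forall>\<^sub>F s in at_right 0. s * norm h + s\<^sup>2 / t < h x - b"
    using x(2) by (intro order_tendstoD(2)) auto
  moreover have "\<forall>\<^sub>F s in at_right 0. s < d" "\<forall>\<^sub>F s in at_right 0. s < r - dist \<psi> \<phi>"
    using d \<psi> by (auto intro!: eventually_at_right_real eventually_at_rightI[of 0])
  moreover have "\<forall>\<^sub>F s in at_right (0::real). s > 0"
    by (rule eventually_at_right_less)
  ultimately have "\<forall>\<^sub>F s in at_right 0. s > 0 \<and> s < d \<and> s < r - dist \<psi> \<phi> \<and> s * norm h + s\<^sup>2 / t < h x - b"
    by eventually_elim auto
  then obtain s where s: "s > 0" "s < d" "s < r - dist \<psi> \<phi>" "s * norm h + s\<^sup>2 / t < h x - b"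
    using eventually_happens'[OF trivial_limit_at_right_real] by blast
  define a where "a = Sup (blinfun_apply \<psi> ` C) - s\<^sup>2"
  have approx: "\<exists>w\<in>A. h w > b \<and> dist (f w) (f y) < e/3" if y: "y \<in> C" "blinfun_apply \<psi> y > a" for y
  proof -
    obtain w where w: "w \<in> A" "dist w y \<le> s"
      using attain[of y s \<psi>] y s unfolding a_def by auto
    \<comment> \<open>As \<open>\<phi>'\<close> is maximal at \<open>x\<close>, dropping its
      contribution to \<open>\<psi> x - \<psi> y\<close> leaves \<open>t * (h x - h y)\<close> as a
      lower bound.\<close>
    have "\<psi> x \<le> \<psi> y + s\<^sup>2"
      using le_Sup[OF x(1), of \<psi>] y(2) unfolding a_def by simp
    then have "t * (h x - h y) \<le> s\<^sup>2"
      using x(4)[OF y(1)] unfolding \<psi>_def by (simp add: blinfun.bilinear_simps algebra_simps)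
    then have "h x - h y \<le> s\<^sup>2 / t"
      using t(1) by (simp add: field_simps)
    moreover have "\<bar>h w - h y\<bar> \<le> s * norm h"
    proof -
      have "\<bar>h w - h y\<bar> \<le> norm h * norm (w - y)"
        using norm_blinfun[of h "w - y"] by (simp add: blinfun.diff_right)
      also have "\<dots> \<le> norm h * s"
        using w(2) by (intro mult_left_mono) (auto simp: dist_norm)
      finally show ?thesis by (simp add: mult.commute)
    qed
    ultimately have "h w > b" using s(4) by linarith
    moreover have "dist (f w) (f y) < e/3"
      using d(2)[of y w] w y s(2) unfolding A_def by auto
    ultimately show ?thesis using w by blast
  qed
  obtain x0 where "x0 \<in> C" "blinfun_apply \<psi> x0 > a"
    using near[of "s\<^sup>2" \<psi>] s(1) unfolding a_def by auto
  then show thesis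
  proof (rule that[OF \<psi>])
    fix y z assume yz: "y \<in> C" "z \<in> C" "blinfun_apply \<psi> y > a" "blinfun_apply \<psi> z > a"
    obtain v w where "v \<in> A" "h v > b" "dist (f v) (f y) < e/3" "w \<in> A" "h w > b" "dist (f w) (f z) < e/3"
      using approx yz by meson
    then show "dist (f y) (f z) \<le> e"
      using osc[of v w] dist_triangle[of "f y" "f z" "f v"] dist_triangle[of "f v" "f z" "f w"]
      by (simp add: dist_commute)
  qed
qed

section \<open>Stability of slices and finitely many functions\<close>

text \<open>This is the openness half. On the bounded set \<open>C\<close>, nearby functionals
  differ by less than half the gap \<open>\<phi> x - a\<close>, so the midpoint of \<open>a\<close>
  and \<open>\<phi> x\<close> is a level that keeps \<open>x\<close> and excludes all points outside
  the old slice.\<close>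

lemma slice_stable:
  fixes C :: "'a::real_normed_vector set" and \<phi> :: "'a \<Rightarrow>\<^sub>L real"
  assumes C: "bounded C" and x: "x \<in> C" "\<phi> x > a"
  obtains d where "d > 0"
    "\<And>\<psi>. dist \<psi> \<phi> < d \<Longrightarrow> \<exists>b. blinfun_apply \<psi> x > b \<and> (\<forall>z\<in>C. blinfun_apply \<psi> z > b \<longrightarrow> \<phi> z > a)"
proof -
  obtain R where R: "R > 0" "\<And>z. z \<in> C \<Longrightarrow> norm z \<le> R"
    using C unfolding bounded_pos by auto
  define d where "d = (\<phi> x - a) / (2 * R)"
  have d: "d > 0" "2 * (d * R) = \<phi> x - a"
    using R(1) x(2) unfolding d_def by auto
  show thesis
  proof (rule that[OF d(1)])
    fix \<psi> :: "'a \<Rightarrow>\<^sub>L real" assume \<psi>: "dist \<psi> \<phi> < d"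
    have diff: "\<bar>\<psi> z - \<phi> z\<bar> < d * R" if "z \<in> C" for z
    proof -
      have "\<bar>\<psi> z - \<phi> z\<bar> \<le> norm (\<psi> - \<phi>) * norm z"
        using norm_blinfun[of "\<psi> - \<phi>" z] by (simp add: blinfun.diff_left)
      also have "\<dots> \<le> norm (\<psi> - \<phi>) * R"
        using R(2)[OF that] by (intro mult_left_mono) auto
      also have "\<dots> < d * R" using \<psi> R(1) by (simp add: dist_norm)
      finally show ?thesis .
    qed
    show "\<exists>b. blinfun_apply \<psi> x > b \<and> (\<forall>z\<in>C. blinfun_apply \<psi> z > b \<longrightarrow> \<phi> z > a)"
    proof (intro exI conjI ballI impI)
      show "blinfun_apply \<psi> x > a + d * R"
        using diff[OF x(1)] d(2) by linarith
      show "\<phi> z > a" if "z \<in> C" "blinfun_apply \<psi> z > a + d * R" for z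
        using diff[OF that(1)] that(2) by linarith
    qed
  qed
qed

text \<open>A Baire-type induction for finitely many open dense sets: each new function needs a
  perturbation small enough to preserve the slice already found.\<close>

lemma dense_common_slicing_functionals:
  fixes C :: "'a::banach set" and f :: "'i \<Rightarrow> 'a \<Rightarrow> 'm::metric_space" and \<phi> :: "'a \<Rightarrow>\<^sub>L real"
  assumes C: "C \<noteq> {}" "bounded C" "closed C" "convex C"
    and "finite I"
    and "\<And>i. i \<in> I \<Longrightarrow> uniformly_continuous_on C (f i)" "\<And>i. i \<in> I \<Longrightarrow> dentable_on C (f i)"
    and r: "r > 0" and e: "e > 0"
  shows "\<exists>\<psi> a. dist \<psi> \<phi> < r \<and> (\<exists>x\<in>C. blinfun_apply \<psi> x > a) \<and>
    (\<forall>i\<in>I. \<forall>y\<in>C. \<forall>z\<in>C. blinfun_apply \<psi> y > a \<and> blinfun_apply \<psi> z > a \<longrightarrow> dist (f i y) (f i z) \<le> e)"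
  using assms(5-7)
proof (induction I rule: finite_induct)
  case empty
  obtain x where "x \<in> C" using C(1) by auto
  then show ?case
    using r by (intro exI[of _ \<phi>] exI[of _ "\<phi> x - 1"]) (auto intro!: bexI[of _ x])
next
  case (insert j I)
  then obtain \<psi> a x where \<psi>: "dist \<psi> \<phi> < r" "x \<in> C" "blinfun_apply \<psi> x > a"
      "\<And>i y z. \<lbrakk>i \<in> I; y \<in> C; z \<in> C; blinfun_apply \<psi> y > a; blinfun_apply \<psi> z > a\<rbrakk> \<Longrightarrow> dist (f i y) (f i z) \<le> e"
    by (metis insertI2)
  obtain d where d: "d > 0"
      "\<And>\<theta>. dist \<theta> \<psi> < d \<Longrightarrow> \<exists>b. blinfun_apply \<theta> x > b \<and> (\<forall>z\<in>C. blinfun_apply \<theta> z > b \<longrightarrow> \<psi> z > a)"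
    using slice_stable[OF C(2) \<psi>(2,3)] by blast
  \<comment> \<open>One bound preserves the old slice, the other keeps the new functional within
    \<open>r\<close> of \<open>\<phi>\<close>.\<close>
  have "min d (r - dist \<psi> \<phi>) > 0" using d \<psi> by simp
  then obtain \<theta> c w where \<theta>: "dist \<theta> \<psi> < min d (r - dist \<psi> \<phi>)" "w \<in> C" "blinfun_apply \<theta> w > c"
      "\<And>y z. \<lbrakk>y \<in> C; z \<in> C; blinfun_apply \<theta> y > c; blinfun_apply \<theta> z > c\<rbrakk> \<Longrightarrow> dist (f j y) (f j z) \<le> e"
    using dense_slicing_functionals[OF C insert.prems(1,2)[of j] _ e] by (metis insertI1)
  obtain b where b: "blinfun_apply \<theta> x > b" "\<forall>z\<in>C. blinfun_apply \<theta> z > b \<longrightarrow> \<psi> z > a"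
    using d(2)[of \<theta>] \<theta>(1) by auto
  show ?case
  proof (intro exI conjI)
    show "dist \<theta> \<phi> < r" using dist_triangle[of \<theta> \<phi> \<psi>] \<theta>(1) by simp
    \<comment> \<open>Two slices by the same functional are nested, so the one of \<open>x\<close>
      and \<open>w\<close> with the larger value lies in both.\<close>
    show "\<exists>x\<in>C. blinfun_apply \<theta> x > max b c"
      using b(1) \<theta>(2,3) \<psi>(2) by (cases "blinfun_apply \<theta> w \<le> blinfun_apply \<theta> x")
        (auto intro: bexI[of _ x] bexI[of _ w])
    show "\<forall>i\<in>insert j I. \<forall>y\<in>C. \<forall>z\<in>C. blinfun_apply \<theta> y > max b c \<and> blinfun_apply \<theta> z > max b c
        \<longrightarrow> dist (f i y) (f i z) \<le> e"
      using \<theta>(4) \<psi>(4) b(2) by auto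
  qed
qed

theorem proposition1p3:
  fixes C :: "'a::banach set"
    and f :: "nat \<Rightarrow> 'a \<Rightarrow> real"
    and n :: nat
    and \<epsilon> :: real
  assumes "C \<noteq> {}" and "bounded C" and "closed C" and "convex C"
    and "n \<ge> 1"
    and "\<And>i. i \<in> {1..n} \<Longrightarrow> uniformly_continuous_on C (f i)"
    and "\<And>i. i \<in> {1..n} \<Longrightarrow> dentable_on C (f i)"
    and "\<epsilon> > 0"
  shows "\<exists>H. open_half_space H \<and> C \<inter> H \<noteq> {} \<and>
           Max ((\<lambda>i. ediameter (f i ` (C \<inter> H))) ` {1..n}) < ennreal \<epsilon>"
proof -
  have "\<epsilon> / 2 > 0" using assms(8) by simp
  from dense_common_slicing_functionals[where I = "{1..n}" and f = f and \<phi> = 0,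
      OF assms(1-4) finite_atLeastAtMost assms(6,7) zero_less_one this]
  obtain \<psi> :: "'a \<Rightarrow>\<^sub>L real" and a where \<psi>: "\<exists>x\<in>C. blinfun_apply \<psi> x > a"
      "\<And>i y z. \<lbrakk>i \<in> {1..n}; y \<in> C; z \<in> C; blinfun_apply \<psi> y > a; blinfun_apply \<psi> z > a\<rbrakk>
        \<Longrightarrow> dist (f i y) (f i z) \<le> \<epsilon> / 2"
    by blast
  define H where "H = {x. blinfun_apply \<psi> x > a}"
  have "ediameter (f i ` (C \<inter> H)) < ennreal \<epsilon>" if "i \<in> {1..n}" for i
  proof -
    \<comment> \<open>A supremum of distances inherits only a weak bound; the halved constant
      restores strictness.\<close>
    have "ediameter (f i ` (C \<inter> H)) \<le> ennreal (\<epsilon> / 2)"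
      unfolding ediameter_def using \<psi>(2)[OF that]
      by (intro SUP_least) (auto simp: H_def intro!: ennreal_leI)
    also have "\<dots> < ennreal \<epsilon>"
      using assms(8) by (intro ennreal_lessI) auto
    finally show ?thesis .
  qed
  then have "Max ((\<lambda>i. ediameter (f i ` (C \<inter> H))) ` {1..n}) < ennreal \<epsilon>"
    \<comment> \<open>\<open>n \<ge> 1\<close> makes the index set nonempty, as comparison with
      \<open>Max\<close> demands.\<close>
    using assms(5) by (subst Max_less_iff) auto
  moreover have "open_half_space H" "C \<inter> H \<noteq> {}"
    using \<psi>(1) unfolding open_half_space_def H_def by auto
  ultimately show ?thesis by blast
qed

end
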